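(* Let $\mathcal{H}$ be a Hilbert space, let $T\in L(\mathcal{H})$ be a product of two orthogonal projections, and let $\mathcal{M},\mathcal{N}$ be closed subspaces of $\mathcal{H}$. Then $T=P_{\mathcal{M}}P_{\mathcal{N}}$ if and only if there exist closed subspaces $\mathcal{M}_1,\mathcal{N}_1$ of $\mathcal{H}$ such that (1) $\mathcal{M}=\overline{R(T)}\oplus\mathcal{M}_1$; (2) $\mathcal{N}=N(T)^\perp\oplus\mathcal{N}_1$; (3) $\mathcal{M}_1\perp\mathcal{N}_1$; (4) $\mathcal{M}_1\oplus\mathcal{N}_1\subseteq R(T)^\perp\cap N(T)$.
   Context: $L(\mathcal{H})$ is the algebra of bounded linear operators on $\mathcal{H}$; $R(T)$ and $N(T)$ denote range and nullspace. $P_{\mathcal{M}}$ is the orthogonal projection onto the closed subspace $\mathcal{M}$. The symbol $\oplus$ denotes the sum of mutually orthogonal closed subspaces. *)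

theory Defs
  imports "HOL-Analysis.Analysis" "HOL-Library.Set_Algebras"
begin

text \<open>
  Scalar fields of Hilbert spaces. Every element \<open>z\<close> is a root of
  \<open>X\<^sup>2 - (z + rc_cnj z) X + (norm z)\<^sup>2\<close>, whose coefficients are real, so up to
  isomorphism the only models are \<open>real\<close> and \<open>complex\<close>.
\<close>

class real_or_complex = real_normed_field +
  fixes rc_cnj :: "'a \<Rightarrow> 'a"
  assumes rc_cnj_add: "rc_cnj (x + y) = rc_cnj x + rc_cnj y"
    and rc_cnj_mult: "rc_cnj (x * y) = rc_cnj x * rc_cnj y"
    and mult_rc_cnj: "x * rc_cnj x = (norm x)\<^sup>2 *\<^sub>R 1"

instantiation real :: real_or_complex
begin
definition rc_cnj_real :: "real \<Rightarrow> real" where "rc_cnj_real x = x"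
instance
  by standard (simp_all add: rc_cnj_real_def power2_eq_square)
end

instantiation complex :: real_or_complex
begin
definition rc_cnj_complex :: "complex \<Rightarrow> complex" where "rc_cnj_complex = cnj"
instance
  by standard
    (simp_all add: rc_cnj_complex_def scaleR_conv_of_real complex_norm_square [symmetric]
      del: of_real_power)
end

text \<open>
  A Hilbert space over the scalar field \<open>'k\<close>. The library norm of the carrier type, for which it
  is complete, is required to be the one induced by the inner product (linear in the first
  argument), so that \<open>closed\<close>, \<open>closure\<close> and \<open>bounded_linear\<close> have their usual meaning.
\<close>

locale hilbert_space = vector_space smul
  for smul :: "'k::real_or_complex \<Rightarrow> 'a::banach \<Rightarrow> 'a" +
  fixes ip :: "'a \<Rightarrow> 'a \<Rightarrow> 'k"
  assumes smul_of_real: "smul (of_real r) x = r *\<^sub>R x"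
    and ip_add_left: "ip (x + y) z = ip x z + ip y z"
    and ip_smul_left: "ip (smul c x) y = c * ip x y"
    and ip_commute: "ip y x = rc_cnj (ip x y)"
    and ip_self: "ip x x = of_real ((norm x)\<^sup>2)"

lemma hilbert_space_real:
  "hilbert_space scaleR (inner :: 'a::{real_inner, banach} \<Rightarrow> 'a \<Rightarrow> real)"
  by unfold_locales
    (simp_all add: inner_add_left inner_add_right inner_commute rc_cnj_real_def power2_norm_eq_inner
      scaleR_right_distrib scaleR_left_distrib)

lemma hilbert_space_complex: "hilbert_space (*) (\<lambda>x y :: complex. x * cnj y)"
  by unfold_locales
    (simp_all add: algebra_simps rc_cnj_complex_def scaleR_conv_of_real complex_norm_square [symmetric]
      del: of_real_power)

definition bounded_operator :: "('k::real_or_complex \<Rightarrow> 'a::banach \<Rightarrow> 'a) \<Rightarrow> ('a \<Rightarrow> 'a) \<Rightarrow> bool" where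
  "bounded_operator smul T \<longleftrightarrow> Vector_Spaces.linear smul smul T \<and> bounded_linear T"

definition closed_subspace :: "('k::real_or_complex \<Rightarrow> 'a::banach \<Rightarrow> 'a) \<Rightarrow> 'a set \<Rightarrow> bool" where
  "closed_subspace smul M \<longleftrightarrow> module.subspace smul M \<and> closed M"

definition perp :: "('a \<Rightarrow> 'a \<Rightarrow> 'k::real_or_complex) \<Rightarrow> 'a set \<Rightarrow> 'a set \<Rightarrow> bool" where
  "perp ip A B \<longleftrightarrow> (\<forall>a\<in>A. \<forall>b\<in>B. ip a b = 0)"

definition orth_compl :: "('a \<Rightarrow> 'a \<Rightarrow> 'k::real_or_complex) \<Rightarrow> 'a set \<Rightarrow> 'a set" where
  "orth_compl ip S = {x. \<forall>y\<in>S. ip x y = 0}"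

definition nullspace :: "('a \<Rightarrow> 'b::zero) \<Rightarrow> 'a set" where
  "nullspace T = {x. T x = 0}"

text \<open>Meaningful for closed subspaces \<open>M\<close>, where the described point exists and is unique.\<close>

definition orth_proj :: "('a::banach \<Rightarrow> 'a \<Rightarrow> 'k::real_or_complex) \<Rightarrow> 'a set \<Rightarrow> 'a \<Rightarrow> 'a" where
  "orth_proj ip M x = (THE y. y \<in> M \<and> x - y \<in> orth_compl ip M)"

text \<open>
  \<open>M = A \<oplus> B\<close>: the symbol carries the claim that \<open>A\<close> and \<open>B\<close> are closed subspaces orthogonal to
  each other, so it is rendered as a relation; \<open>+\<close> on sets is elementwise.
\<close>

definition is_orth_sum ::
  "('k::real_or_complex \<Rightarrow> 'a::banach \<Rightarrow> 'a) \<Rightarrow> ('a \<Rightarrow> 'a \<Rightarrow> 'k) \<Rightarrow> 'a set \<Rightarrow> 'a set \<Rightarrow> 'a set \<Rightarrow> bool" where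
  "is_orth_sum smul ip M A B \<longleftrightarrow>
     closed_subspace smul A \<and> closed_subspace smul B \<and> perp ip A B \<and> M = A + B"

end

theory Submission imports Defs begin

text \<open>
  If \<open>T = P\<^sub>M P\<^sub>N\<close>, then \<open>R(T) \<subseteq> M\<close> and \<open>N(T)\<^sup>\<bottom> \<subseteq> N\<close>, and the summands are
  \<open>M\<^sub>1 = M \<inter> R(T)\<^sup>\<bottom>\<close> and \<open>N\<^sub>1 = N \<inter> N(T)\<close>: \<open>P\<^sub>N\<close> kills \<open>M\<^sub>1\<close> and \<open>P\<^sub>M\<close> kills \<open>N\<^sub>1\<close>.
  Conversely, let \<open>T = P\<^sub>A P\<^sub>B\<close>. The \<open>N(T)\<^sup>\<bottom>\<close>-component \<open>q\<close> of \<open>P\<^sub>N x\<close> satisfies \<open>x - q \<in> N(T)\<close> and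
  \<open>q \<in> B\<close>, so \<open>T x = T q = P\<^sub>A q\<close>; the orthogonality relations then identify \<open>T q\<close> with
  \<open>P\<^sub>M (P\<^sub>N x)\<close>.
\<close>

context hilbert_space
begin

subsection \<open>Inner product\<close>

lemma rc_cnj_zero [simp]: "rc_cnj (0::'k) = 0"
  using rc_cnj_add [of "0::'k" 0] by simp

lemma ip_zero_left [simp]: "ip 0 y = 0"
  using ip_add_left [of 0 0 y] by simp

lemma ip_zero_right [simp]: "ip x 0 = 0"
  by (metis ip_commute ip_zero_left rc_cnj_zero)

lemma ip_add_right: "ip x (y + z) = ip x y + ip x z"
  by (metis ip_add_left ip_commute rc_cnj_add)

lemma ip_diff_left: "ip (x - y) z = ip x z - ip y z"
  using ip_add_left [of "x - y" y z] by simp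

lemma ip_diff_right: "ip x (y - z) = ip x y - ip x z"
  using ip_add_right [of x "y - z" z] by simp

lemma ip_eq_zero_commute: "ip x y = 0 \<longleftrightarrow> ip y x = 0"
  by (metis ip_commute rc_cnj_zero)

lemma ip_self_eq_zero_iff [simp]: "ip x x = 0 \<longleftrightarrow> x = 0"
  by (simp add: ip_self)

text \<open>\<open>smul_of_real\<close> gives homogeneity of the norm for real scalars only. For
  general ones it comes from \<open>ip_self\<close>, since the inner product turns the scalar into
  \<open>c * rc_cnj c\<close>.\<close>

lemma norm_smul: "norm (smul c x) = norm c * norm x"
proof -
  have "ip (smul c x) (smul c x) = c * rc_cnj c * ip x x"
    by (metis ip_commute ip_smul_left mult.assoc rc_cnj_mult)
  then have "(of_real ((norm (smul c x))\<^sup>2) :: 'k) = of_real ((norm c * norm x)\<^sup>2)"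
    by (simp only: ip_self mult_rc_cnj) (simp add: power_mult_distrib scaleR_conv_of_real)
  then have "(norm (smul c x))\<^sup>2 = (norm c * norm x)\<^sup>2"
    by (simp only: of_real_eq_iff)
  then show ?thesis
    by (simp add: power2_eq_iff_nonneg)
qed

lemma pythagoras:
  assumes "ip x y = 0"
  shows "(norm (x + y))\<^sup>2 = (norm x)\<^sup>2 + (norm y)\<^sup>2"
proof -
  have "ip (x + y) (x + y) = ip x x + ip y y"
    using assms ip_eq_zero_commute [of x y] by (simp add: ip_add_left ip_add_right)
  then have "(of_real ((norm (x + y))\<^sup>2) :: 'k) = of_real ((norm x)\<^sup>2 + (norm y)\<^sup>2)"
    by (simp only: ip_self of_real_add)
  then show ?thesis
    by (simp only: of_real_eq_iff)
qed

lemma parallelogram: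
  fixes x y :: 'a
  shows "(norm (x + y))\<^sup>2 + (norm (x - y))\<^sup>2 = 2 * (norm x)\<^sup>2 + 2 * (norm y)\<^sup>2"
proof -
  \<comment> \<open>Doubled terms are written as sums, so that \<open>ip_self\<close> and
    \<open>of_real_add\<close> carry the identity over to the reals.\<close>
  have "ip (x + y) (x + y) + ip (x - y) (x - y) = ip x x + ip x x + (ip y y + ip y y)"
    by (simp add: ip_add_left ip_add_right ip_diff_left ip_diff_right)
  then have "(of_real ((norm (x + y))\<^sup>2 + (norm (x - y))\<^sup>2) :: 'k)
      = of_real ((norm x)\<^sup>2 + (norm x)\<^sup>2 + ((norm y)\<^sup>2 + (norm y)\<^sup>2))"
    by (simp only: ip_self of_real_add)
  then show ?thesis
    by (simp only: of_real_eq_iff)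
qed

lemma ip_component_eq_zero:
  assumes "z \<noteq> 0"
  shows "ip (x - smul (ip x z / ip z z) z) z = 0"
  using assms by (simp add: ip_diff_left ip_smul_left)

text \<open>Pythagoras for the splitting of \<open>x\<close> along \<open>z\<close>. Dropping the
  first term gives Cauchy-Schwarz; the second is the gain that forces nearest points to have
  orthogonal residuals.\<close>

lemma norm_component:
  assumes "z \<noteq> 0"
  shows "(norm x)\<^sup>2 = (norm (x - smul (ip x z / ip z z) z))\<^sup>2 + (norm (ip x z) / norm z)\<^sup>2"
proof -
  let ?w = "smul (ip x z / ip z z) z"
  have "ip z (x - ?w) = 0"
    using ip_component_eq_zero [OF assms] by (simp add: ip_eq_zero_commute)
  then have "ip (x - ?w) ?w = 0"
    by (simp add: ip_eq_zero_commute [of "x - ?w"] ip_smul_left)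
  then have "(norm x)\<^sup>2 = (norm (x - ?w))\<^sup>2 + (norm ?w)\<^sup>2"
    using pythagoras [of "x - ?w" ?w] by simp
  moreover have "norm ?w = norm (ip x z) / norm z"
    using assms by (simp add: norm_smul norm_divide ip_self power2_eq_square norm_mult)
  ultimately show ?thesis
    by simp
qed

lemma cauchy_schwarz: "norm (ip x z) \<le> norm x * norm z"
proof (cases "z = 0")
  case False
  have "(norm (ip x z) / norm z)\<^sup>2 \<le> (norm x)\<^sup>2"
    using norm_component [OF False, of x] by simp
  then have "norm (ip x z) / norm z \<le> norm x"
    by (rule power2_le_imp_le) simp
  then show ?thesis
    using False by (simp add: divide_le_eq)
qed simp

lemma bounded_linear_ip_left: "bounded_linear (\<lambda>x. ip x z)"
proof (rule bounded_linear_intro)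
  show "ip (r *\<^sub>R x) z = r *\<^sub>R ip x z" for r x
    by (simp add: smul_of_real [symmetric] ip_smul_left scaleR_conv_of_real)
qed (rule ip_add_left cauchy_schwarz)+

lemma bounded_linear_smul: "bounded_linear (smul c)"
proof (rule bounded_linear_intro)
  show "smul c (r *\<^sub>R x) = r *\<^sub>R smul c x" for r x
    by (simp add: smul_of_real [symmetric] mult.commute)
  show "norm (smul c x) \<le> norm x * norm c" for x
    by (simp add: norm_smul)
qed (rule scale_right_distrib)

subsection \<open>Orthogonal complements and projections\<close>

lemma closed_subspace_orth_compl: "closed_subspace smul (orth_compl ip S)"
proof -
  have "closed (\<Inter>y\<in>S. {x. ip x y = 0})"
    by (intro closed_INT ballI closed_Collect_eq continuous_intros
        linear_continuous_on bounded_linear_ip_left)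
  moreover have "orth_compl ip S = (\<Inter>y\<in>S. {x. ip x y = 0})"
    by (auto simp: orth_compl_def)
  moreover have "subspace (orth_compl ip S)"
    by (auto simp: subspace_def orth_compl_def ip_add_left ip_smul_left)
  ultimately show ?thesis
    by (simp add: closed_subspace_def)
qed

lemma closed_subspace_Int:
  "closed_subspace smul A \<Longrightarrow> closed_subspace smul B \<Longrightarrow> closed_subspace smul (A \<inter> B)"
  by (auto simp: closed_subspace_def subspace_inter)

lemma closed_subspace_closure:
  assumes "subspace S"
  shows "closed_subspace smul (closure S)"
proof -
  have "0 \<in> closure S"
    using assms closure_subset subspace_0 by blast
  moreover have "x + y \<in> closure S" if "x \<in> closure S" "y \<in> closure S" for x y
  proof -
    have "x + y \<in> closure (S + S)"
      using that closure_sum [of S S] by (auto intro: set_plus_intro)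
    moreover have "S + S \<subseteq> S"
      using assms by (auto simp: set_plus_def subspace_add)
    ultimately show ?thesis
      using closure_mono by blast
  qed
  moreover have "smul c x \<in> closure S" if "x \<in> closure S" for c x
  proof -
    have "smul c x \<in> closure (smul c ` S)"
      using that closure_bounded_linear_image_subset [OF bounded_linear_smul] by blast
    moreover have "smul c ` S \<subseteq> S"
      using assms by (auto simp: subspace_scale)
    ultimately show ?thesis
      using closure_mono by blast
  qed
  ultimately show ?thesis
    by (simp add: closed_subspace_def subspace_def)
qed

text \<open>Symmetry of orthogonality makes \<open>orth_compl ip\<close> an antitone Galois
  connection with itself.\<close>

lemma subset_orth_compl_commute: "A \<subseteq> orth_compl ip B \<longleftrightarrow> B \<subseteq> orth_compl ip A"
  using ip_eq_zero_commute by (fastforce simp: orth_compl_def)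

lemma subset_orth_compl_orth_compl: "S \<subseteq> orth_compl ip (orth_compl ip S)"
  using subset_orth_compl_commute by blast

text \<open>The double complement of \<open>S\<close> is closed and contains \<open>S\<close>, hence
  contains \<open>closure S\<close>.\<close>

lemma orth_compl_closure: "orth_compl ip (closure S) = orth_compl ip S"
proof
  show "orth_compl ip (closure S) \<subseteq> orth_compl ip S"
    using closure_subset by (fastforce simp: orth_compl_def)
  have "closure S \<subseteq> orth_compl ip (orth_compl ip S)"
    using closed_subspace_orth_compl subset_orth_compl_orth_compl
    by (simp add: closure_minimal closed_subspace_def)
  then show "orth_compl ip S \<subseteq> orth_compl ip (closure S)"
    using subset_orth_compl_commute by blast
qed

text \<open>A minimizing sequence is Cauchy by the parallelogram law, because midpoints stay in
  \<open>M\<close>; completeness and closedness supply its limit.\<close>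

lemma nearest_point_exists:
  assumes "closed_subspace smul M"
  obtains y where "y \<in> M" "\<And>z. z \<in> M \<Longrightarrow> norm (x - y) \<le> norm (x - z)"
proof -
  have sub: "subspace M" and cl: "closed M"
    using assms by (auto simp: closed_subspace_def)
  define d where "d = (INF z\<in>M. norm (x - z))"
  have bdd: "bdd_below ((\<lambda>z. norm (x - z)) ` M)"
    by (rule bdd_belowI2 [of _ 0]) simp
  have ne: "M \<noteq> {}"
    using sub subspace_0 by auto
  have d_le: "d \<le> norm (x - z)" if "z \<in> M" for z
    unfolding d_def using bdd that by (rule cINF_lower)
  have d0: "0 \<le> d"
    unfolding d_def using ne by (rule cINF_greatest) simp
  have "\<exists>z\<in>M. norm (x - z) < d + inverse (real (Suc n))" for n
    using cINF_less_iff [OF ne bdd, of "d + inverse (real (Suc n))"]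
    by (simp add: d_def)
  then obtain f where f: "\<And>n. f n \<in> M" "\<And>n. norm (x - f n) < d + inverse (real (Suc n))"
    by metis
  have lim: "(\<lambda>n. norm (x - f n)) \<longlonglongrightarrow> d"
  proof (rule tendsto_sandwich)
    show "\<forall>\<^sub>F n in sequentially. d \<le> norm (x - f n)"
      using d_le f(1) by simp
    show "\<forall>\<^sub>F n in sequentially. norm (x - f n) \<le> d + inverse (real (Suc n))"
      using f(2) by (simp add: less_imp_le)
    show "(\<lambda>n. d + inverse (real (Suc n))) \<longlonglongrightarrow> d"
      using tendsto_add [OF tendsto_const LIMSEQ_inverse_real_of_nat, of d] by simp
  qed simp
  have close: "(norm (f m - f n))\<^sup>2 \<le> 2 * ((norm (x - f m))\<^sup>2 - d\<^sup>2) + 2 * ((norm (x - f n))\<^sup>2 - d\<^sup>2)"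
    for m n
  proof -
    \<comment> \<open>The midpoint is at distance at least \<open>d\<close> from \<open>x\<close>,
      so the sum term of the parallelogram law is at least 4 times the square of
      \<open>d\<close>.\<close>
    let ?c = "smul (of_real (1/2)) (f m + f n)"
    have "?c \<in> M"
      by (intro subspace_scale subspace_add sub f)
    then have "d\<^sup>2 \<le> (norm (x - ?c))\<^sup>2"
      using d_le d0 by (simp add: power_mono)
    moreover have "(x - f m) + (x - f n) = 2 *\<^sub>R (x - ?c)"
      unfolding smul_of_real by (simp add: algebra_simps scaleR_2)
    then have "(norm ((x - f m) + (x - f n)))\<^sup>2 = 4 * (norm (x - ?c))\<^sup>2"
      by (simp add: power_mult_distrib)
    moreover have "norm ((x - f m) - (x - f n)) = norm (f m - f n)"
      by (simp add: norm_minus_commute)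
    ultimately show ?thesis
      using parallelogram [of "x - f m" "x - f n"] by simp
  qed
  have "Cauchy f"
  proof (rule metric_CauchyI)
    fix e :: real
    assume e: "0 < e"
    have "(\<lambda>n. (norm (x - f n))\<^sup>2) \<longlonglongrightarrow> d\<^sup>2"
      using lim by (rule tendsto_power)
    \<comment> \<open>With this bound each of the two terms in \<open>close\<close> is below half
      the square of \<open>e\<close>.\<close>
    then have "\<forall>\<^sub>F n in sequentially. (norm (x - f n))\<^sup>2 < d\<^sup>2 + e\<^sup>2 / 4"
      using e by (intro order_tendstoD) auto
    then obtain k where k: "\<And>n. n \<ge> k \<Longrightarrow> (norm (x - f n))\<^sup>2 < d\<^sup>2 + e\<^sup>2 / 4"
      by (auto simp: eventually_sequentially)
    have "dist (f m) (f n) < e" if "m \<ge> k" "n \<ge> k" for m n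
    proof -
      have "(norm (f m - f n))\<^sup>2 < e\<^sup>2"
        using close [of m n] k [OF that(1)] k [OF that(2)] by argo
      then show ?thesis
        using e by (simp add: dist_norm power2_less_imp_less)
    qed
    then show "\<exists>k. \<forall>m\<ge>k. \<forall>n\<ge>k. dist (f m) (f n) < e"
      by blast
  qed
  then obtain y where y: "f \<longlonglongrightarrow> y"
    using Cauchy_convergent_iff convergent_def by blast
  have "y \<in> M"
    using cl f(1) y closed_sequentially by blast
  moreover have "(\<lambda>n. norm (x - f n)) \<longlonglongrightarrow> norm (x - y)"
    using y by (intro tendsto_intros)
  then have "norm (x - y) = d"
    using lim LIMSEQ_unique by blast
  ultimately show ?thesis
    using that d_le by simp
qed

text \<open>A variational argument: if the residual of the nearest point had a nonzero component
  along some \<open>z\<close> in \<open>M\<close>, adding that component to the point would bring it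
  closer to \<open>x\<close>.\<close>

lemma orth_proj_exists:
  assumes "closed_subspace smul M"
  obtains y where "y \<in> M" "x - y \<in> orth_compl ip M"
proof -
  obtain y where y: "y \<in> M" "\<And>z. z \<in> M \<Longrightarrow> norm (x - y) \<le> norm (x - z)"
    using nearest_point_exists [OF assms] by metis
  have "ip (x - y) z = 0" if z: "z \<in> M" for z
  proof (cases "z = 0")
    case False
    let ?w = "smul (ip (x - y) z / ip z z) z"
    have "y + ?w \<in> M"
      using assms y z by (simp add: closed_subspace_def subspace_add subspace_scale)
    then have "norm (x - y) \<le> norm (x - y - ?w)"
      using y(2) [of "y + ?w"] by (simp add: diff_diff_eq)
    then have "(norm (x - y))\<^sup>2 \<le> (norm (x - y - ?w))\<^sup>2"
      by (simp add: power_mono)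
    then have "(norm (ip (x - y) z) / norm z)\<^sup>2 \<le> 0"
      using norm_component [OF False, of "x - y"] by linarith
    then show ?thesis
      using False by simp
  qed simp
  then show ?thesis
    using that y(1) by (simp add: orth_compl_def)
qed

text \<open>Gives access to the definite description: two candidates differ by a vector that lies in
  \<open>M\<close> and is orthogonal to \<open>M\<close>, hence to itself.\<close>

lemma orth_proj_eqI:
  assumes "closed_subspace smul M" "y \<in> M" "x - y \<in> orth_compl ip M"
  shows "orth_proj ip M x = y"
  unfolding orth_proj_def
proof (rule the_equality)
  fix z
  assume z: "z \<in> M \<and> x - z \<in> orth_compl ip M"
  have "z - y \<in> M"
    using assms z by (simp add: closed_subspace_def subspace_diff)
  then have "ip (x - y) (z - y) = 0" "ip (x - z) (z - y) = 0"
    using assms z by (auto simp: orth_compl_def)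
  then have "ip (z - y) (z - y) = 0"
    by (simp add: ip_diff_left)
  then show "z = y"
    by simp
qed (use assms in auto)

lemma
  assumes "closed_subspace smul M"
  shows orth_proj_in: "orth_proj ip M x \<in> M"
    and diff_orth_proj: "x - orth_proj ip M x \<in> orth_compl ip M"
  using orth_proj_exists [OF assms, of x] orth_proj_eqI [OF assms, of _ x] by metis+

lemma orth_proj_zero_iff:
  assumes "closed_subspace smul M"
  shows "orth_proj ip M x = 0 \<longleftrightarrow> x \<in> orth_compl ip M"
  using orth_proj_eqI [OF assms, of 0 x] diff_orth_proj [OF assms, of x] assms
  by (auto simp: closed_subspace_def subspace_0)

lemma ip_orth_proj_right:
  assumes "closed_subspace smul M" "m \<in> M"
  shows "ip m (orth_proj ip M x) = ip m x"
proof -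
  have "ip (x - orth_proj ip M x) m = 0"
    using diff_orth_proj [OF assms(1)] assms(2) by (simp add: orth_compl_def)
  then have "ip m (x - orth_proj ip M x) = 0"
    using ip_eq_zero_commute by blast
  then show ?thesis
    by (simp add: ip_diff_right)
qed

lemma orth_proj_idem:
  assumes "closed_subspace smul M" "x \<in> M"
  shows "orth_proj ip M x = x"
  using assms by (intro orth_proj_eqI) (auto simp: orth_compl_def)

text \<open>For \<open>x\<close> in the double complement, the residual of its projection is
  orthogonal both to \<open>x\<close> and to the projection, hence to itself.\<close>

lemma orth_compl_orth_compl:
  assumes "closed_subspace smul M"
  shows "orth_compl ip (orth_compl ip M) = M"
proof
  show "M \<subseteq> orth_compl ip (orth_compl ip M)"
    by (rule subset_orth_compl_orth_compl)
  show "orth_compl ip (orth_compl ip M) \<subseteq> M"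
  proof
    fix x
    assume x: "x \<in> orth_compl ip (orth_compl ip M)"
    let ?y = "orth_proj ip M x"
    have y: "?y \<in> M" "x - ?y \<in> orth_compl ip M"
      using assms orth_proj_in diff_orth_proj by auto
    then have "ip ?y (x - ?y) = 0" "ip x (x - ?y) = 0"
      using x by (auto simp: orth_compl_def ip_eq_zero_commute [of ?y])
    then have "ip (x - ?y) (x - ?y) = 0"
      by (simp add: ip_diff_left)
    then show "x \<in> M"
      using y by simp
  qed
qed

text \<open>Projecting onto \<open>K\<close> splits each \<open>x\<close> in \<open>M\<close>, and
  the residual stays in \<open>M\<close> because \<open>K\<close> does. Both orthogonal sums of the
  theorem are instances.\<close>

lemma is_orth_sum_Int_orth_compl:
  assumes "closed_subspace smul M" "closed_subspace smul K" "K \<subseteq> M"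
  shows "is_orth_sum smul ip M K (M \<inter> orth_compl ip K)"
proof -
  have "M = K + (M \<inter> orth_compl ip K)"
  proof
    show "M \<subseteq> K + (M \<inter> orth_compl ip K)"
    proof
      fix x
      assume "x \<in> M"
      let ?y = "orth_proj ip K x"
      have y: "?y \<in> K" "x - ?y \<in> orth_compl ip K"
        using assms orth_proj_in diff_orth_proj by auto
      then have "x - ?y \<in> M"
        using assms \<open>x \<in> M\<close> by (auto simp: closed_subspace_def intro: subspace_diff)
      then have "?y + (x - ?y) \<in> K + (M \<inter> orth_compl ip K)"
        using y by (intro set_plus_intro) auto
      then show "x \<in> K + (M \<inter> orth_compl ip K)"
        by simp
    qed
    show "K + (M \<inter> orth_compl ip K) \<subseteq> M"
      using assms by (auto simp: set_plus_def closed_subspace_def intro: subspace_add)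
  qed
  moreover have "perp ip K (M \<inter> orth_compl ip K)"
    using ip_eq_zero_commute by (auto simp: perp_def orth_compl_def)
  ultimately show ?thesis
    using assms closed_subspace_Int closed_subspace_orth_compl by (auto simp: is_orth_sum_def)
qed

lemma closed_subspace_right_summand: "is_orth_sum smul ip M A B \<Longrightarrow> closed_subspace smul B"
  by (simp add: is_orth_sum_def)

lemma is_orth_sum_left_subset:
  assumes "is_orth_sum smul ip M A B"
  shows "A \<subseteq> M"
proof
  fix a
  assume "a \<in> A"
  moreover have "0 \<in> B"
    using assms by (auto simp: is_orth_sum_def closed_subspace_def subspace_0)
  ultimately have "a + 0 \<in> A + B"
    by (rule set_plus_intro)
  then show "a \<in> M"
    using assms by (simp add: is_orth_sum_def)
qed

subsection \<open>Products of two projections\<close>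

lemma
  assumes "bounded_operator smul T"
  shows closed_subspace_nullspace: "closed_subspace smul (nullspace T)"
    and closed_subspace_closure_range: "closed_subspace smul (closure (range T))"
proof -
  interpret T: Vector_Spaces.linear smul smul T
    using assms by (simp add: bounded_operator_def)
  have "closed (nullspace T)"
    unfolding nullspace_def using assms
    by (intro closed_Collect_eq linear_continuous_on continuous_intros) (simp add: bounded_operator_def)
  moreover have "subspace (nullspace T)"
    using T.subspace_kernel by (simp add: nullspace_def)
  ultimately show "closed_subspace smul (nullspace T)"
    by (simp add: closed_subspace_def)
  show "closed_subspace smul (closure (range T))"
    by (intro closed_subspace_closure T.subspace_image) simp
qed

lemma
  assumes "closed_subspace smul M" "closed_subspace smul N"
    and T: "T = orth_proj ip M \<circ> orth_proj ip N"
  shows closure_range_subset: "closure (range T) \<subseteq> M"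
    and orth_compl_nullspace_subset: "orth_compl ip (nullspace T) \<subseteq> N"
proof -
  show "closure (range T) \<subseteq> M"
    using assms orth_proj_in by (intro closure_minimal) (auto simp: closed_subspace_def)
  have "orth_proj ip M 0 = 0"
    by (simp add: orth_proj_zero_iff [OF assms(1)] orth_compl_def)
  \<comment> \<open>\<open>T\<close> kills whatever its right factor kills; passing to complements
    reverses the inclusion.\<close>
  then have "orth_compl ip N \<subseteq> nullspace T"
    by (auto simp: T nullspace_def orth_proj_zero_iff [OF assms(2), symmetric])
  then have "orth_compl ip (nullspace T) \<subseteq> orth_compl ip (orth_compl ip N)"
    by (auto simp: orth_compl_def)
  then show "orth_compl ip (nullspace T) \<subseteq> N"
    by (simp add: orth_compl_orth_compl assms)
qed

lemma product_orth_proj_decomposition: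
  assumes bo: "bounded_operator smul T"
    and M: "closed_subspace smul M" and N: "closed_subspace smul N"
    and T: "T = orth_proj ip M \<circ> orth_proj ip N"
  defines "M1 \<equiv> M \<inter> orth_compl ip (range T)" and "N1 \<equiv> N \<inter> nullspace T"
  shows "is_orth_sum smul ip M (closure (range T)) M1"
    and "is_orth_sum smul ip N (orth_compl ip (nullspace T)) N1"
    and "perp ip M1 N1"
    and "M1 + N1 \<subseteq> orth_compl ip (range T) \<inter> nullspace T"
proof -
  let ?R = "orth_compl ip (range T)" and ?K = "nullspace T"
  have K: "closed_subspace smul ?K"
    using bo by (rule closed_subspace_nullspace)
  show "is_orth_sum smul ip M (closure (range T)) M1"
    using is_orth_sum_Int_orth_compl [OF M closed_subspace_closure_range [OF bo]
        closure_range_subset [OF M N T]]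
    by (simp add: M1_def orth_compl_closure)
  show "is_orth_sum smul ip N (orth_compl ip ?K) N1"
    using is_orth_sum_Int_orth_compl [OF N closed_subspace_orth_compl
        orth_compl_nullspace_subset [OF M N T]]
    by (simp add: N1_def orth_compl_orth_compl [OF K])
  \<comment> \<open>On \<open>N\<close> the operator \<open>T\<close> acts as the projection onto
    \<open>M\<close>, so vectors of \<open>N\<close> killed by \<open>T\<close> are orthogonal to
    all of \<open>M\<close>.\<close>
  have N1: "n \<in> orth_compl ip M" if "n \<in> N1" for n
  proof -
    have "orth_proj ip M n = T n"
      using that by (simp add: T N1_def orth_proj_idem [OF N])
    then show ?thesis
      using that by (simp add: orth_proj_zero_iff [OF M, symmetric] N1_def nullspace_def)
  qed
  then show "perp ip M1 N1"
    using ip_eq_zero_commute by (fastforce simp: perp_def M1_def orth_compl_def)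
  \<comment> \<open>Since \<open>m\<close> lies in \<open>M\<close>, the left factor of
    \<open>T\<close> can be moved off: \<open>ip m ?p\<close> equals \<open>ip m (T m)\<close>,
    which is 0 as \<open>m\<close> is orthogonal to the range. As \<open>ip ?p ?p = ip ?p m\<close>,
    the projection \<open>?p\<close> vanishes.\<close>
  have "m \<in> ?K" if m: "m \<in> M1" for m
  proof -
    let ?p = "orth_proj ip N m"
    have "ip m ?p = ip m (T m)"
      using m by (simp add: T M1_def ip_orth_proj_right [OF M])
    also have "\<dots> = 0"
      using m by (simp add: M1_def orth_compl_def)
    finally have "ip ?p m = 0"
      by (simp add: ip_eq_zero_commute)
    then have "ip ?p ?p = 0"
      by (simp add: ip_orth_proj_right [OF N orth_proj_in [OF N]])
    then show ?thesis
      by (simp add: T nullspace_def orth_proj_zero_iff [OF M]) (simp add: orth_compl_def)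
  qed
  then have "M1 \<subseteq> ?R \<inter> ?K"
    by (auto simp: M1_def)
  moreover have "N1 \<subseteq> ?R \<inter> ?K"
    using N1 closure_range_subset [OF M N T] closure_subset [of "range T"]
    by (fastforce simp: N1_def orth_compl_def)
  moreover have "subspace (?R \<inter> ?K)"
    using K closed_subspace_orth_compl by (simp add: closed_subspace_def subspace_inter)
  ultimately show "M1 + N1 \<subseteq> ?R \<inter> ?K"
    using subspace_add [of "?R \<inter> ?K"] unfolding set_plus_def by blast
qed

text \<open>The decomposition alone does not determine \<open>T\<close>: twice the identity, with
  \<open>M\<close> and \<open>N\<close> the whole space, satisfies it. The factorization through
  \<open>A\<close> and \<open>B\<close> fixes \<open>T\<close> on
  \<open>orth_compl ip (nullspace T)\<close>.\<close>

lemma product_orth_proj_if_decomposition: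
  assumes bo: "bounded_operator smul T"
    and A: "closed_subspace smul A" and B: "closed_subspace smul B"
    and T: "T = orth_proj ip A \<circ> orth_proj ip B"
    and M: "closed_subspace smul M" and N: "closed_subspace smul N"
    and sumM: "is_orth_sum smul ip M (closure (range T)) M1"
    and sumN: "is_orth_sum smul ip N (orth_compl ip (nullspace T)) N1"
    and perp: "perp ip M1 N1"
    and sub: "M1 + N1 \<subseteq> orth_compl ip (range T) \<inter> nullspace T"
  shows "T = orth_proj ip M \<circ> orth_proj ip N"
proof
  fix x
  have K: "closed_subspace smul (nullspace T)"
    using bo by (rule closed_subspace_nullspace)
  \<comment> \<open>Adding 0 from the other summand turns the inclusion of \<open>M1 + N1\<close>
    into one for each summand.\<close>
  have zero: "0 \<in> M1" "0 \<in> N1"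
    using sumM sumN by (auto simp: is_orth_sum_def closed_subspace_def subspace_0)
  have M1: "m \<in> orth_compl ip (range T)" "m \<in> nullspace T" if "m \<in> M1" for m
    using sub set_plus_intro [OF that zero(2)] by auto
  have N1: "n \<in> orth_compl ip (closure (range T))" "n \<in> nullspace T" if "n \<in> N1" for n
    using sub set_plus_intro [OF zero(1) that] by (auto simp: orth_compl_closure)
  obtain q n where q: "q \<in> orth_compl ip (nullspace T)" and n: "n \<in> N1"
    and pN: "orth_proj ip N x = q + n"
    using orth_proj_in [OF N, of x] sumN by (auto simp: is_orth_sum_def set_plus_def)
  \<comment> \<open>The residual of \<open>x\<close> is orthogonal to \<open>N\<close>, in
    particular to \<open>orth_compl ip (nullspace T)\<close>, so it lies in the nullspace. So does
    \<open>n\<close>; only \<open>q\<close> contributes to \<open>T x\<close>.\<close>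
  have "x - (q + n) \<in> orth_compl ip (orth_compl ip (nullspace T))"
    using diff_orth_proj [OF N, of x] is_orth_sum_left_subset [OF sumN]
    by (auto simp: pN orth_compl_def)
  then have "x - (q + n) \<in> nullspace T"
    by (simp add: orth_compl_orth_compl [OF K])
  then have Tx: "T x = T q"
    using bo N1(2) [OF n] by (simp add: nullspace_def bounded_operator_def linear_simps)
  have "T q = orth_proj ip A q"
    using q orth_compl_nullspace_subset [OF A B T] by (simp add: T orth_proj_idem [OF B] subset_iff)
  then have "q - T q \<in> orth_compl ip A"
    using diff_orth_proj [OF A] by simp
  then have qR: "q - T q \<in> orth_compl ip (closure (range T))"
    using closure_range_subset [OF A B T] by (auto simp: orth_compl_def)
  \<comment> \<open>It remains to see that \<open>T q\<close> is the projection of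
    \<open>q + n\<close> onto \<open>M\<close>. The residual is tested against both summands of
    \<open>M\<close>: against \<open>r\<close> the vectors \<open>q - T q\<close> and
    \<open>n\<close> vanish separately, against \<open>m\<close> each of \<open>q\<close>,
    \<open>n\<close> and \<open>T q\<close> does.\<close>
  have "q + n - T q \<in> orth_compl ip M"
  proof -
    have "ip (q + n - T q) (r + m) = 0" if r: "r \<in> closure (range T)" and m: "m \<in> M1" for r m
    proof -
      have "ip (q - T q) r = 0" "ip n r = 0"
        using qR N1(1) [OF n] r by (auto simp: orth_compl_def)
      moreover have "ip q m = 0"
        using q M1(2) [OF m] by (simp add: orth_compl_def)
      moreover have "ip (T q) m = 0" "ip n m = 0"
        using M1(1) [OF m] perp m n ip_eq_zero_commute by (auto simp: orth_compl_def perp_def)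
      ultimately show ?thesis
        by (simp add: ip_add_right ip_add_left ip_diff_left)
    qed
    then show ?thesis
      using sumM by (auto simp: orth_compl_def is_orth_sum_def set_plus_def)
  qed
  moreover have "T q \<in> M"
    using is_orth_sum_left_subset [OF sumM] closure_subset [of "range T"] by auto
  ultimately have "orth_proj ip M (q + n) = T q"
    by (intro orth_proj_eqI [OF M])
  then show "T x = (orth_proj ip M \<circ> orth_proj ip N) x"
    by (simp add: pN Tx)
qed

end

theorem theorem3p7:
  fixes smul :: "'k::real_or_complex \<Rightarrow> 'a::banach \<Rightarrow> 'a"
    and ip :: "'a \<Rightarrow> 'a \<Rightarrow> 'k"
    and T :: "'a \<Rightarrow> 'a"
    and M N :: "'a set"
  assumes "hilbert_space smul ip"
    and "bounded_operator smul T"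
    and "\<exists>A B. closed_subspace smul A \<and> closed_subspace smul B
           \<and> T = orth_proj ip A \<circ> orth_proj ip B"
    and "closed_subspace smul M"
    and "closed_subspace smul N"
  shows "T = orth_proj ip M \<circ> orth_proj ip N \<longleftrightarrow>
    (\<exists>M1 N1. closed_subspace smul M1 \<and> closed_subspace smul N1
       \<and> is_orth_sum smul ip M (closure (range T)) M1
       \<and> is_orth_sum smul ip N (orth_compl ip (nullspace T)) N1
       \<and> perp ip M1 N1
       \<and> M1 + N1 \<subseteq> orth_compl ip (range T) \<inter> nullspace T)"
    (is "?product \<longleftrightarrow> ?decomposition")
proof -
  interpret hilbert_space smul ip
    by fact
  show ?thesis
  proof
    assume ?product
    note dec = product_orth_proj_decomposition [OF assms(2,4,5) this]
    have "closed_subspace smul (M \<inter> orth_compl ip (range T))"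
      "closed_subspace smul (N \<inter> nullspace T)"
      by (rule dec(1,2) [THEN closed_subspace_right_summand])+
    with dec show ?decomposition
      by iprover
  next
    assume ?decomposition
    then obtain M1 N1 where dec: "is_orth_sum smul ip M (closure (range T)) M1"
      "is_orth_sum smul ip N (orth_compl ip (nullspace T)) N1" "perp ip M1 N1"
      "M1 + N1 \<subseteq> orth_compl ip (range T) \<inter> nullspace T"
      by (elim exE conjE)
    obtain A B where "closed_subspace smul A" "closed_subspace smul B"
      "T = orth_proj ip A \<circ> orth_proj ip B"
      using assms(3) by (elim exE conjE)
    then show ?product
      using assms(4,5) dec by (rule product_orth_proj_if_decomposition [OF assms(2)])
  qed
qed

end
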